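(* Let $D=\{a_n\}_{n\in\mathbb{N}}\subset\mathbb{R}^k$ be a discrete multiple set and let $\mu_D=\sum_{n\in\mathbb{N}}\delta_{a_n}$ be the measure with a unit mass at each point of $D$, counted with multiplicity. Then $D$ is almost periodic (as a discrete multiple set) if and only if $\mu_D$ is an almost periodic measure.
   Context: A discrete multiple set $\{a_n\}_{n\in\mathbb{N}}$ in $\mathbb{R}^k$ is the value set, counted with multiplicity, of a sequence $(a_n)_{n=1}^\infty\subset\mathbb{R}^k$ having no finite limit points (equivalently, every bounded set contains $a_n$ for only finitely many indices $n$). Two sequences differing by a permutation of indices define the same discrete multiple set. For discrete multiple sets put $\mathrm{dist}(\{a_n\}_{n\in\mathbb{N}},\{b_n\}_{n\in\mathbb{N}})=\inf_{\sigma}\sup_{n\in\mathbb{N}}|a_n-b_{\sigma(n)}|\in[0,\infty]$, the infimum over all bijections $\sigma:\mathbb{N}\to\mathbb{N}$, where $|\cdot|$ is the Euclidean norm. A vector $\tau\in\mathbb{R}^k$ is an $\varepsilon$-almost period of $\{a_n\}_{n\in\mathbb{N}}$ if $\mathrm{dist}(\{a_n\}_{n\in\mathbb{N}},\{a_n+\tau\}_{n\in\mathbb{N}})<\varepsilon$. A set $E\subset\mathbb{R}^k$ is relatively dense if there is $L<\infty$ such that every ball of radius $L$ in $\mathbb{R}^k$ meets $E$. A discrete multiple set is almost periodic if for each $\varepsilon>0$ the set of its $\varepsilon$-almost periods is relatively dense in $\mathbb{R}^k$. A continuous function $g$ on $\mathbb{R}^k$ is almost periodic if for every $\varepsilon>0$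 the set of $\tau\in\mathbb{R}^k$ with $|g(x-\tau)-g(x)|<\varepsilon$ for all $x\in\mathbb{R}^k$ is relatively dense. A locally finite complex-valued Radon measure $\mu$ on $\mathbb{R}^k$ is almost periodic if for each compactly supported continuous function $\varphi$ on $\mathbb{R}^k$ the function $\varphi*\mu(z)=\int_{\mathbb{R}^k}\varphi(y-z)\,d\mu(y)$ is almost periodic on $\mathbb{R}^k$. *)

theory Defs
  imports "HOL-Probability.Probability"
begin

text \<open>
  A multiple set is represented by an enumerating sequence; the notions below do not depend
  on the order of enumeration.
\<close>

definition discrete_multiple_set :: "(nat \<Rightarrow> 'a::euclidean_space) \<Rightarrow> bool" where
  "discrete_multiple_set a \<longleftrightarrow> (\<forall>B. bounded B \<longrightarrow> finite {n. a n \<in> B})"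

definition multiple_set_dist ::
    "(nat \<Rightarrow> 'a::euclidean_space) \<Rightarrow> (nat \<Rightarrow> 'a) \<Rightarrow> ennreal" where
  "multiple_set_dist a b = (INF \<sigma>\<in>{\<sigma>. bij \<sigma>}. SUP n. ennreal (norm (a n - b (\<sigma> n))))"

definition relatively_dense :: "'a::euclidean_space set \<Rightarrow> bool" where
  "relatively_dense E \<longleftrightarrow> (\<exists>L. \<forall>x. ball x L \<inter> E \<noteq> {})"

definition almost_period :: "real \<Rightarrow> (nat \<Rightarrow> 'a::euclidean_space) \<Rightarrow> 'a \<Rightarrow> bool" where
  "almost_period \<epsilon> a \<tau> \<longleftrightarrow> multiple_set_dist a (\<lambda>n. a n + \<tau>) < ennreal \<epsilon>"

definition almost_periodic_multiple_set :: "(nat \<Rightarrow> 'a::euclidean_space) \<Rightarrow> bool" where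
  "almost_periodic_multiple_set a \<longleftrightarrow>
     (\<forall>\<epsilon>>0. relatively_dense {\<tau>. almost_period \<epsilon> a \<tau>})"

definition almost_periodic_function :: "('a::euclidean_space \<Rightarrow> complex) \<Rightarrow> bool" where
  "almost_periodic_function g \<longleftrightarrow>
     continuous_on UNIV g \<and>
     (\<forall>\<epsilon>>0. relatively_dense {\<tau>. \<forall>x. norm (g (x - \<tau>) - g x) < \<epsilon>})"

definition measure_convolution ::
    "('a::euclidean_space \<Rightarrow> complex) \<Rightarrow> 'a measure \<Rightarrow> 'a \<Rightarrow> complex" where
  "measure_convolution \<phi> M z = (\<integral>y. \<phi> (y - z) \<partial>M)"

text \<open>
  Almost periodicity of a complex-valued Radon measure is stated here for nonnegative ones, which
  are values of the type \<^typ>\<open>'a measure\<close>.  A Borel measure on a Euclidean space that is finite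
  on compact sets is automatically a Radon measure.
\<close>

definition locally_finite_borel_measure :: "'a::euclidean_space measure \<Rightarrow> bool" where
  "locally_finite_borel_measure M \<longleftrightarrow>
     sets M = sets borel \<and> (\<forall>K. compact K \<longrightarrow> emeasure M K < \<infinity>)"

definition almost_periodic_measure :: "'a::euclidean_space measure \<Rightarrow> bool" where
  "almost_periodic_measure M \<longleftrightarrow>
     locally_finite_borel_measure M \<and>
     (\<forall>\<phi>. continuous_on UNIV \<phi> \<and> compact (closure {x. \<phi> x \<noteq> 0}) \<longrightarrow>
        almost_periodic_function (measure_convolution \<phi> M))"

text \<open>The measure \<open>return borel x\<close> is the unit mass at \<open>x\<close>.\<close>

definition multiple_set_measure :: "(nat \<Rightarrow> 'a::euclidean_space) \<Rightarrow> 'a measure" where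
  "multiple_set_measure a =
     measure_of UNIV (sets borel) (\<lambda>A. \<Sum>n. emeasure (return borel (a n)) A)"

text \<open>
  The function passed to \<^const>\<open>measure_of\<close> is countably additive, so it is the measure
  obtained (otherwise \<^const>\<open>measure_of\<close> would yield the zero measure).
\<close>

lemma sets_multiple_set_measure [simp]: "sets (multiple_set_measure a) = sets borel"
  unfolding multiple_set_measure_def
  by (metis sets.sets_measure_of_eq space_borel)

lemma emeasure_multiple_set_measure:
  assumes "A \<in> sets borel"
  shows "emeasure (multiple_set_measure a) A = (\<Sum>n. emeasure (return borel (a n)) A)"
proof (rule emeasure_measure_of[OF multiple_set_measure_def])
  show "countably_additive (sets (multiple_set_measure a))
          (\<lambda>A. \<Sum>n. emeasure (return borel (a n)) A)"
  proof (rule countably_additiveI)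
    fix F :: "nat \<Rightarrow> 'a set"
    assume F: "range F \<subseteq> sets (multiple_set_measure a)" "disjoint_family F"
    have "(\<Sum>i. \<Sum>n. emeasure (return borel (a n)) (F i)) =
          (\<integral>\<^sup>+ n. (\<Sum>i. emeasure (return borel (a n)) (F i)) \<partial>count_space UNIV)"
      by (subst nn_integral_suminf) (auto simp: nn_integral_count_space_nat)
    also have "\<dots> = (\<Sum>n. \<Sum>i. emeasure (return borel (a n)) (F i))"
      by (simp add: nn_integral_count_space_nat)
    also have "\<dots> = (\<Sum>n. emeasure (return borel (a n)) (\<Union>i. F i))"
      using F by (simp add: suminf_indicator)
    finally show "(\<Sum>i. \<Sum>n. emeasure (return borel (a n)) (F i)) =
                  (\<Sum>n. emeasure (return borel (a n)) (\<Union>i. F i))" .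
  qed
qed (use assms in \<open>auto simp: positive_def\<close>)

end

theory Submission
  imports Defs
begin

text \<open>
  Convolving \<open>\<phi>\<close> with the counting measure of \<open>D = {a\<^sub>n}\<close> gives the locally finite sum
  \<open>g z = (\<Sum>n. \<phi> (a\<^sub>n - z))\<close>, and \<open>g (z - \<tau>)\<close> is the same sum for the shifted set \<open>D + \<tau>\<close>.  So the
  theorem compares two ways of saying that \<open>D\<close> and \<open>D + \<tau>\<close> are close: by matching their points and
  by testing against \<open>\<phi>\<close>.  In both directions the number of points of \<open>D\<close> in a ball of fixed radius
  is bounded uniformly in its centre, because almost periods reduce
  the question to balls close to the origin.

  From multiple sets to measures: a matching of \<open>D\<close> with \<open>D + \<tau>\<close> pairs up the summands of \<open>g z\<close> and
  \<open>g (z - \<tau>)\<close>.  Paired summands are close by uniform continuity of \<open>\<phi>\<close>, and a bounded number of them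
  is nonzero.

  From measures to multiple sets: if no ball of radius 1 contains more than \<open>C\<close> points of \<open>D\<close>, then
  none contains more than \<open>2 * C\<close> points of \<open>D\<close> and \<open>D + \<tau>\<close> together.  A chain with steps below
  \<open>\<delta>\<close> that moved farther than \<open>(2 * C + 1) * \<delta> \<le> 1\<close> from its start would put a point in each of
  \<open>2 * C + 1\<close> concentric shells, so for small \<open>\<delta>\<close> every \<open>\<delta>\<close>-chain component of the union is small
  (\<open>linked_imp_close\<close>), while different components are at least \<open>\<delta>\<close> apart.  It remains to find
  \<open>\<tau>\<close> for which every component contains as many points of \<open>D\<close> as of \<open>D + \<tau>\<close>; the points can then
  be matched inside components (\<open>ex_bij_equal_fibres\<close>).

  One test function suffices for all components: a tent \<open>\<phi>\<close> of radius \<open>\<delta> / 2\<close>.  The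
  \<open>\<delta> / 2\<close>-neighbourhood of a component sees only the points of that component, and integrating
  \<open>g z\<close> over it gives \<open>\<integral>\<phi>\<close> times the number of points of \<open>D\<close> in the component; \<open>g (z - \<tau>)\<close> gives
  the same for \<open>D + \<tau>\<close>.  As the neighbourhoods have bounded volume, a sufficiently good uniform almost
  period \<open>\<tau>\<close> of \<open>g\<close> makes the two integrals differ by less than \<open>\<integral>\<phi>\<close>, and the two integer counts
  agree (\<open>close_tent_convolution_imp_equal_card\<close>).
\<close>

section \<open>Sums over a discrete multiple set\<close>

lemma multiple_set_measure_eq_distr:
  "multiple_set_measure a = distr (count_space UNIV) borel a"
proof (rule measure_eqI)
  fix A assume "A \<in> sets (multiple_set_measure a)"
  then have A: "A \<in> sets borel" by simp
  have "emeasure (distr (count_space UNIV) borel a) A = emeasure (count_space UNIV) (a -` A)"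
    using A by (simp add: emeasure_distr)
  also have "\<dots> = (\<integral>\<^sup>+n. indicator (a -` A) n \<partial>count_space UNIV)"
    by simp
  also have "\<dots> = (\<Sum>n. indicator (a -` A) n)"
    by (rule nn_integral_count_space_nat)
  also have "\<dots> = emeasure (multiple_set_measure a) A"
    using A by (simp add: emeasure_multiple_set_measure indicator_def)
  finally show "emeasure (multiple_set_measure a) A = emeasure (distr (count_space UNIV) borel a) A"
    by simp
qed simp

lemma discrete_finite:
  assumes "discrete_multiple_set a" "bounded B"
  shows "finite {n. a n \<in> B}"
  using assms by (auto simp: discrete_multiple_set_def)

text \<open>
  The finite index set is left free so that one set can serve all \<open>z\<close> in a region, or be the image of
  another index set under a matching.
\<close>

lemma measure_convolution_eq_sum:
  fixes a :: "nat \<Rightarrow> 'a::euclidean_space"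
  assumes \<phi>: "continuous_on UNIV \<phi>"
    and F: "finite F" "\<And>n. \<phi> (a n - z) \<noteq> 0 \<Longrightarrow> n \<in> F"
  shows "measure_convolution \<phi> (multiple_set_measure a) z = (\<Sum>n\<in>F. \<phi> (a n - z))"
proof -
  have [measurable]: "(\<lambda>y. \<phi> (y - z)) \<in> borel_measurable borel"
    by (intro borel_measurable_continuous_onI continuous_on_compose2[OF \<phi>] continuous_intros) auto
  have fin: "finite {n \<in> UNIV. \<phi> (a n - z) \<noteq> 0}"
    by (rule finite_subset[OF _ F(1)]) (use F(2) in auto)
  have "measure_convolution \<phi> (multiple_set_measure a) z
      = (\<integral>n. \<phi> (a n - z) \<partial>count_space UNIV)"
    by (simp add: measure_convolution_def multiple_set_measure_eq_distr integral_distr)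
  also have "\<dots> = (\<Sum>n | n \<in> UNIV \<and> \<phi> (a n - z) \<noteq> 0. \<phi> (a n - z))"
    using fin by (intro lebesgue_integral_count_space_finite_support) simp
  also have "\<dots> = (\<Sum>n\<in>F. \<phi> (a n - z))"
    by (rule sum.mono_neutral_left) (use F in auto)
  finally show ?thesis .
qed

lemma locally_finite_multiple_set_measure:
  fixes a :: "nat \<Rightarrow> 'a::euclidean_space"
  assumes "discrete_multiple_set a"
  shows "locally_finite_borel_measure (multiple_set_measure a)"
  unfolding locally_finite_borel_measure_def
proof (intro conjI allI impI)
  fix K :: "'a set" assume K: "compact K"
  have "finite (a -` K)"
    using discrete_finite[OF assms compact_imp_bounded[OF K]] by (simp add: vimage_def)
  then show "emeasure (multiple_set_measure a) K < \<infinity>"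
    using borel_compact[OF K] by (simp add: multiple_set_measure_eq_distr emeasure_distr of_nat_less_top)
qed simp

text \<open>
  For \<open>z\<close> in a ball of radius 1, the same finitely many points contribute to the convolution.
\<close>

lemma continuous_measure_convolution:
  fixes a :: "nat \<Rightarrow> 'a::euclidean_space"
  assumes a: "discrete_multiple_set a" and \<phi>: "continuous_on UNIV \<phi>"
    and R: "\<And>y. \<phi> y \<noteq> 0 \<Longrightarrow> norm y \<le> R"
  shows "continuous_on UNIV (measure_convolution \<phi> (multiple_set_measure a))"
proof (rule continuous_at_imp_continuous_on, rule ballI)
  fix z0 :: 'a
  define F where "F = {n. a n \<in> cball z0 (R + 1)}"
  have "finite F" unfolding F_def by (intro discrete_finite[OF a]) simp
  have "measure_convolution \<phi> (multiple_set_measure a) z = (\<Sum>n\<in>F. \<phi> (a n - z))"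
    if z: "z \<in> ball z0 1" for z
  proof (rule measure_convolution_eq_sum[OF \<phi> \<open>finite F\<close>])
    fix n assume "\<phi> (a n - z) \<noteq> 0"
    then have "dist (a n) z \<le> R" using R by (simp add: dist_norm)
    then show "n \<in> F"
      using z dist_triangle[of z0 "a n" z] by (simp add: F_def dist_commute)
  qed
  moreover have "continuous_on (ball z0 1) (\<lambda>z. \<Sum>n\<in>F. \<phi> (a n - z))"
    by (intro continuous_intros continuous_on_compose2[OF \<phi>]) auto
  ultimately have "continuous_on (ball z0 1) (measure_convolution \<phi> (multiple_set_measure a))"
    by (subst continuous_on_cong[OF refl])
  then show "isCont (measure_convolution \<phi> (multiple_set_measure a)) z0"
    by (simp add: continuous_on_eq_continuous_at)
qed

section \<open>From almost periodic multiple sets to almost periodic measures\<close>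

lemma almost_period_matching:
  assumes "almost_period \<epsilon> a \<tau>" "\<epsilon> > 0"
  obtains \<sigma> where "bij \<sigma>" "\<And>n. dist (a n) (a (\<sigma> n) + \<tau>) < \<epsilon>"
proof -
  obtain \<sigma> where \<sigma>: "bij \<sigma>" "(SUP n. ennreal (norm (a n - (a (\<sigma> n) + \<tau>)))) < ennreal \<epsilon>"
    using assms(1) by (auto simp: almost_period_def multiple_set_dist_def INF_less_iff)
  have "dist (a n) (a (\<sigma> n) + \<tau>) < \<epsilon>" for n
  proof -
    have "ennreal (norm (a n - (a (\<sigma> n) + \<tau>))) < ennreal \<epsilon>"
      by (rule le_less_trans[OF SUP_upper \<sigma>(2)]) simp
    then show ?thesis by (simp add: dist_norm ennreal_less_iff)
  qed
  with \<sigma>(1) show ?thesis by (rule that)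
qed

text \<open>
  The supremum of the displacements may reach \<open>r\<close>, so a strict bound on each displacement alone
  would not give an almost period for that bound.
\<close>

lemma almost_periodI:
  assumes "bij \<sigma>" "\<And>n. dist (a n) (a (\<sigma> n) + \<tau>) \<le> r" "r < \<epsilon>" "0 < \<epsilon>"
  shows "almost_period \<epsilon> a \<tau>"
proof -
  have "multiple_set_dist a (\<lambda>n. a n + \<tau>) \<le> (SUP n. ennreal (norm (a n - (a (\<sigma> n) + \<tau>))))"
    unfolding multiple_set_dist_def using assms(1) by (intro INF_lower) simp
  also have "\<dots> \<le> ennreal r"
    using assms(2) by (intro SUP_least ennreal_leI) (simp add: dist_norm)
  also have "\<dots> < ennreal \<epsilon>"
    using assms by (intro ennreal_lessI)
  finally show ?thesis by (simp add: almost_period_def)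
qed

text \<open>
  A 1-almost period near the centre \<open>x\<close> matches the points in the ball around \<open>x\<close> injectively with
  points in one fixed ball around the origin.
\<close>

lemma almost_periodic_multiple_set_uniform_count:
  fixes a :: "nat \<Rightarrow> 'a::euclidean_space"
  assumes a: "discrete_multiple_set a" and ap: "almost_periodic_multiple_set a"
  obtains C where "\<And>x. card {n. a n \<in> cball x R} \<le> C"
proof -
  obtain L where L: "\<And>x. ball x L \<inter> {\<tau>. almost_period 1 a \<tau>} \<noteq> {}"
    using ap unfolding almost_periodic_multiple_set_def relatively_dense_def by fastforce
  have "card {n. a n \<in> cball x R} \<le> card {m. a m \<in> cball 0 (R + L + 1)}" for x
  proof -
    obtain \<tau> where \<tau>: "dist x \<tau> < L" "almost_period 1 a \<tau>"
      using L[of x] by auto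
    obtain \<sigma> where \<sigma>: "bij \<sigma>" "\<And>n. dist (a n) (a (\<sigma> n) + \<tau>) < 1"
      using almost_period_matching[OF \<tau>(2)] by auto
    have "norm (a (\<sigma> n)) \<le> R + L + 1" if "dist x (a n) \<le> R" for n
    proof -
      have "norm (a (\<sigma> n)) = dist (a (\<sigma> n) + \<tau>) \<tau>" by (simp add: dist_norm)
      also have "\<dots> \<le> dist (a (\<sigma> n) + \<tau>) (a n) + dist (a n) x + dist x \<tau>"
        using dist_triangle[of "a (\<sigma> n) + \<tau>" \<tau> "a n"] dist_triangle[of "a n" \<tau> x] by linarith
      also have "\<dots> \<le> R + L + 1"
        using that \<tau>(1) \<sigma>(2)[of n] by (simp add: dist_commute)
      finally show ?thesis .
    qed
    then show ?thesis
      using \<sigma>(1) discrete_finite[OF a, of "cball 0 (R + L + 1)"]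
      by (intro card_inj_on_le[of \<sigma>]) (auto intro: inj_on_subset[OF bij_is_inj])
  qed
  then show ?thesis by (rule that)
qed

text \<open>
  The modulus \<open>d\<close> is kept below 1 so that it can also serve as a bound for the displacement of
  points: matched points then stay within distance 1 of the support.
\<close>

lemma compact_support_uniformly_continuous:
  fixes \<phi> :: "'a::euclidean_space \<Rightarrow> complex"
  assumes \<phi>: "continuous_on UNIV \<phi>" and R: "\<And>y. \<phi> y \<noteq> 0 \<Longrightarrow> norm y \<le> R" and "e > 0"
  obtains d where "0 < d" "d \<le> 1" "\<And>x y. dist x y < d \<Longrightarrow> dist (\<phi> x) (\<phi> y) < e"
proof -
  have "uniformly_continuous_on (cball 0 (R + 1)) \<phi>"
    by (intro compact_uniformly_continuous continuous_on_subset[OF \<phi>]) auto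
  then obtain d where d: "d > 0"
    "\<And>x y. x \<in> cball 0 (R+1) \<Longrightarrow> y \<in> cball 0 (R+1) \<Longrightarrow> dist x y < d \<Longrightarrow> dist (\<phi> x) (\<phi> y) < e"
    using \<open>e > 0\<close> unfolding uniformly_continuous_on_def by (metis dist_commute)
  have "dist (\<phi> x) (\<phi> y) < e" if "dist x y < min d 1" for x y
  proof (cases "\<phi> x = 0 \<and> \<phi> y = 0")
    case False
    then have "norm x \<le> R \<or> norm y \<le> R" using R by auto
    then have "norm x \<le> R + 1" "norm y \<le> R + 1"
      using that norm_triangle_sub[of x y] norm_triangle_sub[of y x]
      by (auto simp: dist_norm norm_minus_commute)
    then show ?thesis using d(2)[of x y] that by simp
  qed (use \<open>e > 0\<close> in simp)
  then show ?thesis using d(1) by (intro that[of "min d 1"]) auto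
qed

lemma relatively_dense_mono:
  assumes "relatively_dense E" "E \<subseteq> E'"
  shows "relatively_dense E'"
proof -
  obtain L where "\<And>x. ball x L \<inter> E \<noteq> {}"
    using assms(1) by (auto simp: relatively_dense_def)
  then have "\<And>x. ball x L \<inter> E' \<noteq> {}" using assms(2) by blast
  then show ?thesis by (auto simp: relatively_dense_def)
qed

text \<open>
  Every \<open>d\<close>-almost period of the set, for \<open>d\<close> from uniform continuity, is an \<open>e\<close>-almost period of the
  convolution: the sums at \<open>z\<close> and \<open>z - \<tau>\<close> are indexed by the at most \<open>C\<close> points near \<open>z\<close> and by
  their partners.
\<close>

lemma almost_periodic_measure_if_almost_periodic_multiple_set:
  fixes a :: "nat \<Rightarrow> 'a::euclidean_space"
  assumes a: "discrete_multiple_set a" and ap: "almost_periodic_multiple_set a"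
  shows "almost_periodic_measure (multiple_set_measure a)"
  unfolding almost_periodic_measure_def
proof (intro conjI allI impI)
  show "locally_finite_borel_measure (multiple_set_measure a)"
    by (rule locally_finite_multiple_set_measure[OF a])
next
  fix \<phi> :: "'a \<Rightarrow> complex"
  assume "continuous_on UNIV \<phi> \<and> compact (closure {x. \<phi> x \<noteq> 0})"
  then have \<phi>: "continuous_on UNIV \<phi>" and "bounded {x. \<phi> x \<noteq> 0}"
    using compact_imp_bounded bounded_subset closure_subset by blast+
  then obtain R where R: "\<And>y. \<phi> y \<noteq> 0 \<Longrightarrow> norm y \<le> R"
    unfolding bounded_iff by auto
  let ?g = "measure_convolution \<phi> (multiple_set_measure a)"
  obtain C where C: "\<And>x. card {n. a n \<in> cball x (R + 1)} \<le> C"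
    using almost_periodic_multiple_set_uniform_count[OF a ap] by blast
  show "almost_periodic_function ?g"
    unfolding almost_periodic_function_def
  proof (intro conjI allI impI)
    show "continuous_on UNIV ?g"
      by (rule continuous_measure_convolution[OF a \<phi> R])
  next
    fix e :: real assume "e > 0"
    \<comment> \<open>At most \<open>C\<close> summands matter; the denominator \<open>C + 1\<close> also covers \<open>C = 0\<close>.\<close>
    then have "e / (C + 1) > 0" by simp
    from compact_support_uniformly_continuous[OF \<phi> R this]
    obtain d where d: "0 < d" "d \<le> 1" "\<And>x y. dist x y < d \<Longrightarrow> dist (\<phi> x) (\<phi> y) < e / (C + 1)"
      by blast
    have "norm (?g (z - \<tau>) - ?g z) < e" if \<tau>: "almost_period d a \<tau>" for \<tau> z
    proof -
      obtain \<sigma> where \<sigma>: "bij \<sigma>" "\<And>n. dist (a n) (a (\<sigma> n) + \<tau>) < d"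
        using almost_period_matching[OF \<tau> d(1)] by auto
      define F where "F = {n. a n \<in> cball z (R + 1)}"
      have fin: "finite F" unfolding F_def by (intro discrete_finite[OF a]) simp
      have g: "?g z = (\<Sum>n\<in>F. \<phi> (a n - z))"
      proof (rule measure_convolution_eq_sum[OF \<phi> fin])
        fix n assume "\<phi> (a n - z) \<noteq> 0"
        from R[OF this] show "n \<in> F" by (simp add: F_def dist_norm norm_minus_commute)
      qed
      have "?g (z - \<tau>) = (\<Sum>m\<in>\<sigma> ` F. \<phi> (a m - (z - \<tau>)))"
      proof (rule measure_convolution_eq_sum[OF \<phi>])
        fix m assume "\<phi> (a m - (z - \<tau>)) \<noteq> 0"
        then have m: "dist (a m + \<tau>) z \<le> R" using R by (fastforce simp: dist_norm algebra_simps)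
        obtain n where n: "m = \<sigma> n" using \<sigma>(1) by (metis bij_pointE)
        have "dist z (a n) \<le> R + 1"
          using m \<sigma>(2)[of n] d(2) dist_triangle[of z "a n" "a m + \<tau>"]
          by (simp add: n dist_commute)
        then show "m \<in> \<sigma> ` F" by (auto simp: n F_def)
      qed (use fin in simp)
      also have "\<dots> = (\<Sum>n\<in>F. \<phi> (a (\<sigma> n) - (z - \<tau>)))"
        by (subst sum.reindex) (auto intro: inj_on_subset[OF bij_is_inj[OF \<sigma>(1)]])
      finally have "norm (?g (z - \<tau>) - ?g z)
          = norm (\<Sum>n\<in>F. \<phi> (a (\<sigma> n) - (z - \<tau>)) - \<phi> (a n - z))"
        by (simp add: g sum_subtractf)
      also have "\<dots> \<le> (\<Sum>n\<in>F. e / (C + 1))"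
      proof (rule sum_norm_le)
        fix n
        have "dist (a (\<sigma> n) - (z - \<tau>)) (a n - z) < d"
          using \<sigma>(2)[of n] by (simp add: dist_norm norm_minus_commute algebra_simps)
        from d(3)[OF this] show "norm (\<phi> (a (\<sigma> n) - (z - \<tau>)) - \<phi> (a n - z)) \<le> e / (C + 1)"
          by (simp add: dist_norm)
      qed
      also have "\<dots> \<le> C * (e / (C + 1))"
        using C[of z] \<open>e > 0\<close> by (simp add: F_def mult_right_mono divide_right_mono)
      also have "\<dots> < e" using \<open>e > 0\<close> by (simp add: field_simps)
      finally show ?thesis .
    qed
    moreover have "relatively_dense {\<tau>. almost_period d a \<tau>}"
      using ap d(1) by (simp add: almost_periodic_multiple_set_def)
    ultimately show "relatively_dense {\<tau>. \<forall>x. norm (?g (x - \<tau>) - ?g x) < e}"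
      by (elim relatively_dense_mono) auto
  qed
qed

section \<open>Tent functions\<close>

definition tent :: "real \<Rightarrow> 'a::euclidean_space \<Rightarrow> real" where
  "tent s y = max 0 (s - norm y)"

lemma tent_nonneg: "0 \<le> tent s y"
  by (simp add: tent_def)

lemma tent_eq_0_iff: "tent s y = 0 \<longleftrightarrow> s \<le> norm y"
  by (auto simp: tent_def max_def)

lemma continuous_on_tent: "continuous_on A (\<lambda>y. tent s (f y))" if "continuous_on A f"
  unfolding tent_def by (intro continuous_intros that)

lemma borel_measurable_tent [measurable]: "tent s \<in> borel_measurable (borel :: 'a::euclidean_space measure)"
  by (intro borel_measurable_continuous_onI continuous_on_tent continuous_on_id)

lemma integrable_indicator_ball:
  fixes x :: "'a::euclidean_space" and c :: real
  shows "integrable lborel (\<lambda>y. c * indicator (ball x r) y)"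
  using emeasure_bounded_finite[OF bounded_ball[of x r]]
  by (intro integrable_mult_right integrable_real_indicator) simp_all

lemma integrable_tent: "integrable lborel (tent s :: 'a::euclidean_space \<Rightarrow> real)"
proof (rule Bochner_Integration.integrable_bound)
  show "integrable lborel (\<lambda>y::'a. \<bar>s\<bar> * indicator (ball 0 s) y)"
    by (rule integrable_indicator_ball)
  have "norm (tent s y) \<le> norm (\<bar>s\<bar> * indicator (ball 0 s) y)" for y :: 'a
  proof -
    have "s - norm y \<le> \<bar>s\<bar>" using norm_ge_zero[of y] by linarith
    then show ?thesis by (auto simp: tent_def indicator_def)
  qed
  then show "AE y::'a in lborel. norm (tent s y) \<le> norm (\<bar>s\<bar> * indicator (ball 0 s) y)"
    by simp
qed simp

lemma lborel_tent_reflect: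
  fixes x :: "'a::euclidean_space"
  shows "integrable lborel (\<lambda>z. tent s (x - z))"
    and "(\<integral>z. tent s (x - z) \<partial>lborel) = (\<integral>y. tent s y \<partial>(lborel :: 'a measure))"
proof -
  have L: "(lborel :: 'a measure) = distr lborel borel (\<lambda>z. - x + z)"
    by (rule lborel_distr_plus[symmetric])
  have eq: "tent s (x - z) = tent s (- x + z)" for z by (simp add: tent_def norm_minus_commute)
  show "integrable lborel (\<lambda>z. tent s (x - z))"
    using integrable_tent[of s, where 'a='a] unfolding eq
    by (subst (asm) L) (simp add: integrable_distr_eq)
  show "(\<integral>z. tent s (x - z) \<partial>lborel) = (\<integral>y. tent s y \<partial>(lborel :: 'a measure))"
    unfolding eq by (subst (2) L) (simp add: integral_distr)
qed

lemma integral_tent_pos: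
  assumes "s > 0"
  shows "0 < (\<integral>y. tent s y \<partial>(lborel :: 'a::euclidean_space measure))"
proof -
  have "0 < s / 2 * measure lborel (ball (0::'a) (s / 2))"
    using assms by (intro mult_pos_pos) (auto simp: content_ball_pos)
  also have "\<dots> = (\<integral>y. s / 2 * indicator (ball 0 (s / 2)) y \<partial>(lborel :: 'a measure))"
    by simp
  also have "\<dots> \<le> (\<integral>y. tent s y \<partial>(lborel :: 'a measure))"
  proof (rule integral_mono)
    show "integrable lborel (\<lambda>y::'a. s / 2 * indicator (ball 0 (s / 2)) y)"
      by (rule integrable_indicator_ball)
    show "s / 2 * indicator (ball 0 (s / 2)) y \<le> tent s y" for y :: 'a
      using assms by (auto simp: tent_def indicator_def max_def)
  qed (rule integrable_tent)
  finally show ?thesis .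
qed

lemma almost_periodic_tent_convolution:
  fixes a :: "nat \<Rightarrow> 'a::euclidean_space"
  assumes "almost_periodic_measure (multiple_set_measure a)"
  shows "almost_periodic_function
    (measure_convolution (\<lambda>y. of_real (tent s y)) (multiple_set_measure a))"
proof -
  have "bounded {x::'a. tent s x \<noteq> 0}"
    by (rule bounded_subset[of "ball 0 s"]) (auto simp: tent_eq_0_iff)
  moreover have "continuous_on UNIV (\<lambda>y::'a. complex_of_real (tent s y))"
    by (intro continuous_on_of_real continuous_on_tent continuous_on_id)
  ultimately show ?thesis
    using assms by (simp add: almost_periodic_measure_def)
qed

lemma tent_convolution_eq_sum:
  fixes a :: "nat \<Rightarrow> 'a::euclidean_space"
  assumes "finite F" "\<And>n. dist (a n) z < s \<Longrightarrow> n \<in> F"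
  shows "measure_convolution (\<lambda>y. of_real (tent s y)) (multiple_set_measure a) z
    = of_real (\<Sum>n\<in>F. tent s (a n - z))"
proof -
  have "continuous_on UNIV (\<lambda>y::'a. complex_of_real (tent s y))"
    by (intro continuous_on_of_real continuous_on_tent continuous_on_id)
  from measure_convolution_eq_sum[OF this assms(1), of a z]
  show ?thesis using assms(2) by (simp add: tent_eq_0_iff dist_norm not_le)
qed

section \<open>Uniform local finiteness\<close>

text \<open>
  Up to an error of 1, every value is attained on one compact ball around the origin.
\<close>

lemma almost_periodic_function_bounded:
  assumes "almost_periodic_function g"
  obtains B where "\<And>x. norm (g x) \<le> B"
proof -
  obtain L where L: "\<And>x. ball x L \<inter> {\<tau>. \<forall>x. norm (g (x - \<tau>) - g x) < 1} \<noteq> {}"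
    using assms unfolding almost_periodic_function_def relatively_dense_def by fastforce
  have "continuous_on (cball 0 L) g"
    using assms by (auto simp: almost_periodic_function_def intro: continuous_on_subset)
  then have "bounded (g ` cball 0 L)"
    by (intro compact_imp_bounded compact_continuous_image) auto
  then obtain B where B: "\<And>y. norm y \<le> L \<Longrightarrow> norm (g y) \<le> B"
    unfolding bounded_iff by fastforce
  have "norm (g x) \<le> B + 1" for x
  proof -
    obtain \<tau> where \<tau>: "dist x \<tau> < L" "norm (g (x - \<tau>) - g x) < 1"
      using L[of x] by (metis (mono_tags, lifting) IntE all_not_in_conv mem_Collect_eq mem_ball)
    have "norm (g x) \<le> norm (g (x - \<tau>)) + norm (g (x - \<tau>) - g x)"
      by (metis norm_minus_commute norm_triangle_sub)
    also have "\<dots> \<le> B + 1" using B[of "x - \<tau>"] \<tau> by (simp add: dist_norm)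
    finally show ?thesis .
  qed
  then show ?thesis by (rule that)
qed

text \<open>
  The tent of radius 2 is at least 1 on the unit ball, so its convolution with the measure, a bounded
  function, dominates the number of points in unit balls.
\<close>

lemma almost_periodic_measure_uniform_count:
  fixes a :: "nat \<Rightarrow> 'a::euclidean_space"
  assumes a: "discrete_multiple_set a" and ap: "almost_periodic_measure (multiple_set_measure a)"
  obtains C where "\<And>x. card {n. a n \<in> cball x 1} \<le> C"
proof -
  obtain B where B: "\<And>x. norm (measure_convolution (\<lambda>y. of_real (tent 2 y)) (multiple_set_measure a) x) \<le> B"
    using almost_periodic_function_bounded[OF almost_periodic_tent_convolution[OF ap]] by blast
  have "card {n. a n \<in> cball x 1} \<le> nat \<lfloor>B\<rfloor>" for x
  proof -
    define F where "F = {n. a n \<in> cball x 2}"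
    have fin: "finite F" unfolding F_def by (intro discrete_finite[OF a]) simp
    have "real (card {n. a n \<in> cball x 1}) = (\<Sum>n | a n \<in> cball x 1. 1)" by simp
    also have "\<dots> \<le> (\<Sum>n | a n \<in> cball x 1. tent 2 (a n - x))"
      by (rule sum_mono) (auto simp: tent_def dist_norm norm_minus_commute)
    also have "\<dots> \<le> (\<Sum>n\<in>F. tent 2 (a n - x))"
      by (rule sum_mono2[OF fin]) (auto simp: F_def tent_nonneg)
    also have "\<dots> \<le> norm (complex_of_real (\<Sum>n\<in>F. tent 2 (a n - x)))"
      by (simp only: norm_of_real abs_ge_self)
    also have "\<dots> = norm (measure_convolution (\<lambda>y. of_real (tent 2 y)) (multiple_set_measure a) x)"
      by (subst tent_convolution_eq_sum[OF fin]) (auto simp: F_def dist_commute)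
    also have "\<dots> \<le> B" by (rule B)
    finally show ?thesis by linarith
  qed
  then show ?thesis by (rule that)
qed

section \<open>Clusters\<close>

text \<open>
  Chains run through indices rather than points, so that multiplicities are retained.
\<close>

definition linked :: "real \<Rightarrow> ('i \<Rightarrow> 'a::metric_space) \<Rightarrow> 'i \<Rightarrow> 'i \<Rightarrow> bool" where
  "linked \<delta> p = (\<lambda>i j. dist (p i) (p j) < \<delta>)\<^sup>*\<^sup>*"

lemma linkedI: "dist (p i) (p j) < \<delta> \<Longrightarrow> linked \<delta> p i j"
  by (auto simp: linked_def)

lemma linked_refl: "linked \<delta> p i i"
  by (simp add: linked_def)

lemma linked_trans: "linked \<delta> p i j \<Longrightarrow> linked \<delta> p j k \<Longrightarrow> linked \<delta> p i k"
  by (simp add: linked_def)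

lemma linked_sym: "linked \<delta> p i j \<Longrightarrow> linked \<delta> p j i"
  unfolding linked_def
  by (rule sympD[OF sympI[THEN symp_rtranclp]]) (simp_all add: dist_commute)

lemma linked_class_eq_iff: "Collect (linked \<delta> p i) = Collect (linked \<delta> p j) \<longleftrightarrow> linked \<delta> p i j"
  by (auto dest: linked_sym linked_trans intro: linked_refl)

text \<open>
  Cut the ball around \<open>p i\<close> into \<open>N + 1\<close> shells of thickness \<open>\<delta>\<close>.  By counting, one of them is free
  of points, and a chain with steps below \<open>\<delta>\<close> cannot cross it.
\<close>

lemma linked_imp_close:
  fixes p :: "'i \<Rightarrow> 'a::metric_space" and N :: nat and \<delta> :: real
  assumes fin: "finite {k. p k \<in> cball (p i) 1}" and card: "card {k. p k \<in> cball (p i) 1} \<le> N"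
    and \<delta>: "\<delta> > 0" "real (N + 1) * \<delta> \<le> 1"
    and ij: "linked \<delta> p i j"
  shows "dist (p i) (p j) < real (N + 1) * \<delta>"
proof -
  define A where "A m = {k. real m * \<delta> \<le> dist (p i) (p k) \<and> dist (p i) (p k) < real (m + 1) * \<delta>}" for m
  have "\<exists>m\<le>N. A m = {}"
  proof (rule ccontr)
    assume "\<not> ?thesis"
    then have "\<forall>m\<in>{..N}. \<exists>k. k \<in> A m" by auto
    then obtain f where f: "\<And>m. m \<le> N \<Longrightarrow> f m \<in> A m" by (metis atMost_iff)
    have "inj_on f {..N}"
    proof (rule inj_onI)
      fix m m' assume *: "m \<in> {..N}" "m' \<in> {..N}" "f m = f m'"
      have "real m * \<delta> < real (m' + 1) * \<delta>" "real m' * \<delta> < real (m + 1) * \<delta>"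
        using f[of m] f[of m'] * by (auto simp: A_def)
      then have "real m < real (m' + 1)" "real m' < real (m + 1)"
        using \<delta>(1) mult_less_cancel_right_pos by blast+
      then show "m = m'" by linarith
    qed
    moreover have "f ` {..N} \<subseteq> {k. p k \<in> cball (p i) 1}"
    proof clarsimp
      fix m assume m: "m \<le> N"
      have "real (m + 1) * \<delta> \<le> real (N + 1) * \<delta>" using m \<delta>(1) by (intro mult_right_mono) auto
      then show "dist (p i) (p (f m)) \<le> 1" using f[OF m] \<delta>(2) by (auto simp: A_def)
    qed
    ultimately have "card {..N} \<le> card {k. p k \<in> cball (p i) 1}"
      using fin by (rule card_inj_on_le)
    then show False using card by simp
  qed
  then obtain m where m: "m \<le> N" "A m = {}" by blast
  have "m \<noteq> 0"
  proof
    assume "m = 0"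
    then have "i \<in> A m" using \<delta>(1) by (simp add: A_def)
    then show False using m(2) by blast
  qed
  from ij have "dist (p i) (p j) < real m * \<delta>"
    unfolding linked_def
  proof (induction rule: rtranclp_induct)
    case base
    then show ?case using \<open>m \<noteq> 0\<close> \<delta>(1) by simp
  next
    case (step k l)
    have "dist (p i) (p l) < real (m + 1) * \<delta>"
      using step dist_triangle[of "p i" "p l" "p k"] by (simp add: algebra_simps)
    then show ?case using m(2) by (force simp: A_def)
  qed
  also have "\<dots> \<le> real (N + 1) * \<delta>" using m \<delta>(1) by (intro mult_right_mono) auto
  finally show ?thesis .
qed

text \<open>
  The bijection is glued from bijections of the fibres.  Below, the fibres are the index sets of the
  points of \<open>D\<close>, respectively \<open>D + \<tau>\<close>, in one component.
\<close>

lemma ex_bij_equal_fibres: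
  assumes fin: "\<And>c. finite {x. f x = c}" "\<And>c. finite {y. g y = c}"
    and card: "\<And>c. card {x. f x = c} = card {y. g y = c}"
  obtains \<sigma> where "bij \<sigma>" "\<And>x. g (\<sigma> x) = f x"
proof -
  have "\<forall>c. \<exists>h. bij_betw h {x. f x = c} {y. g y = c}"
    using finite_same_card_bij[OF fin card] by blast
  then obtain h where h: "\<And>c. bij_betw (h c) {x. f x = c} {y. g y = c}" by metis
  define \<sigma> where "\<sigma> x = h (f x) x" for x
  have g: "g (\<sigma> x) = f x" for x
    using bij_betwE[OF h[of "f x"]] by (simp add: \<sigma>_def)
  have "bij \<sigma>"
  proof (rule bijI)
    show "inj \<sigma>"
    proof (rule injI)
      fix x y assume eq: "\<sigma> x = \<sigma> y"
      then have "f x = f y" using g by metis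
      with eq show "x = y"
        using bij_betw_imp_inj_on[OF h[of "f x"]] by (auto simp: \<sigma>_def inj_on_def)
    qed
    show "surj \<sigma>"
      unfolding surj_def
    proof
      fix y
      have "y \<in> h (g y) ` {x. f x = g y}" using bij_betw_imp_surj_on[OF h[of "g y"]] by simp
      then obtain x where "f x = g y" "y = h (g y) x" by auto
      then have "y = \<sigma> x" by (simp add: \<sigma>_def)
      then show "\<exists>x. y = \<sigma> x" ..
    qed
  qed
  then show ?thesis using g by (rule that)
qed

section \<open>From almost periodic measures to almost periodic multiple sets\<close>

text \<open>
  Each summand integrates to \<open>\<integral>tent s\<close>, wherever it is centred.  So the integral of the difference of
  the sums is an integer multiple of \<open>\<integral>tent s\<close>, and it is too small to be a nonzero one.
\<close>

lemma close_tent_convolution_imp_equal_card: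
  fixes a b :: "nat \<Rightarrow> 'a::euclidean_space"
  assumes fin: "finite I" "finite J"
    and bound: "\<And>z. \<bar>(\<Sum>n\<in>I. tent s (a n - z)) - (\<Sum>n\<in>J. tent s (b n - z))\<bar> \<le> \<eta> * indicator (ball x r) z"
    and \<eta>: "\<eta> * measure lborel (ball x r) < (\<integral>y. tent s y \<partial>(lborel :: 'a measure))"
  shows "card I = card J"
proof -
  define c where "c = (\<integral>y. tent s y \<partial>(lborel :: 'a measure))"
  let ?H = "\<lambda>z. (\<Sum>n\<in>I. tent s (a n - z)) - (\<Sum>n\<in>J. tent s (b n - z))"
  have H: "(\<integral>z. ?H z \<partial>lborel) = (real (card I) - real (card J)) * c"
    by (simp add: lborel_tent_reflect c_def left_diff_distrib)
  have int: "integrable lborel ?H"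
    by (intro Bochner_Integration.integrable_diff Bochner_Integration.integrable_sum lborel_tent_reflect)
  have "\<bar>\<integral>z. ?H z \<partial>lborel\<bar> \<le> (\<integral>z. \<bar>?H z\<bar> \<partial>lborel)"
    by (rule integral_abs_bound)
  also have "\<dots> \<le> (\<integral>z. \<eta> * indicator (ball x r) z \<partial>lborel)"
    using int by (intro integral_mono bound integrable_abs integrable_indicator_ball)
  also have "\<dots> = \<eta> * measure lborel (ball x r)" by simp
  also have "\<dots> < c" using \<eta> by (simp add: c_def)
  finally have *: "\<bar>real (card I) - real (card J)\<bar> * \<bar>c\<bar> < c" by (simp add: H abs_mult)
  have c: "c > 0"
    using * by (smt (verit) mult_nonneg_nonneg)
  with * have "\<bar>real (card I) - real (card J)\<bar> < 1" by simp
  then show ?thesis by linarith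
qed

text \<open>
  The constants: \<open>r\<close> bounds the size of the components and stays below both 1 and \<open>\<epsilon>\<close>; \<open>\<delta>\<close> is the
  step of the chains; the tent has radius \<open>s = \<delta> / 2\<close>, so that no tent around a point of one component
  meets a tent around a point of another; and \<open>\<eta>\<close> is the precision of the almost periods of the
  convolution, taken against the volume \<open>V\<close> of a ball of radius 2, which contains every component
  together with its tents.
\<close>

lemma almost_periodic_multiple_set_if_almost_periodic_measure:
  fixes a :: "nat \<Rightarrow> 'a::euclidean_space"
  assumes a: "discrete_multiple_set a" and ap: "almost_periodic_measure (multiple_set_measure a)"
  shows "almost_periodic_multiple_set a"
  unfolding almost_periodic_multiple_set_def
proof (intro allI impI)
  fix \<epsilon> :: real assume "\<epsilon> > 0"
  obtain C where C: "\<And>x. card {n. a n \<in> cball x 1} \<le> C"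
    using almost_periodic_measure_uniform_count[OF a ap] by blast
  define r where "r = min 1 (\<epsilon> / 2)"
  define \<delta> where "\<delta> = r / real (2 * C + 1)"
  define s where "s = \<delta> / 2"
  have r: "0 < r" "r \<le> 1" "r < \<epsilon>" using \<open>\<epsilon> > 0\<close> by (auto simp: r_def)
  have \<delta>: "\<delta> > 0" "real (2 * C + 1) * \<delta> = r" using r by (auto simp: \<delta>_def)
  have "\<delta> \<le> r" using r by (simp add: \<delta>_def divide_le_eq)
  have s: "s > 0" "s \<le> 1" using \<delta> \<open>\<delta> \<le> r\<close> r by (auto simp: s_def)
  define c where "c = (\<integral>y. tent s y \<partial>(lborel :: 'a measure))"
  define V where "V = measure lborel (ball (0::'a) 2)"
  have "c > 0" unfolding c_def by (rule integral_tent_pos[OF s(1)])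
  have "V > 0" unfolding V_def by (simp add: content_ball_pos)
  define \<eta> where "\<eta> = c / (2 * V)"
  have \<eta>: "\<eta> > 0" "\<eta> * V < c" using \<open>c > 0\<close> \<open>V > 0\<close> by (auto simp: \<eta>_def)
  let ?g = "measure_convolution (\<lambda>y. of_real (tent s y)) (multiple_set_measure a)"
  have "almost_period \<epsilon> a \<tau>" if \<tau>: "\<And>x. norm (?g (x - \<tau>) - ?g x) < \<eta>" for \<tau>
  proof -
    define b where "b n = a n + \<tau>" for n
    \<comment> \<open>The union of the set and its shift, with multiplicities.\<close>
    define p where "p = case_sum a b"
    have p [simp]: "p (Inl n) = a n" "p (Inr n) = b n" for n by (simp_all add: p_def)
    define cls where "cls i = Collect (linked \<delta> p i)" for i
    have ballp: "{i. p i \<in> cball x 1} = Inl ` {n. a n \<in> cball x 1} \<union> Inr ` {n. a n \<in> cball (x - \<tau>) 1}" for x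
    proof (rule set_eqI)
      fix i
      show "i \<in> {i. p i \<in> cball x 1} \<longleftrightarrow>
          i \<in> Inl ` {n. a n \<in> cball x 1} \<union> Inr ` {n. a n \<in> cball (x - \<tau>) 1}"
        by (cases i) (auto simp: b_def dist_norm algebra_simps)
    qed
    have finp: "finite {i. p i \<in> cball x 1}" for x
      unfolding ballp by (intro finite_UnI finite_imageI discrete_finite[OF a] bounded_cball)
    have cardp: "card {i. p i \<in> cball x 1} \<le> 2 * C" for x
      unfolding ballp using C[of x] C[of "x - \<tau>"]
      by (intro order_trans[OF card_Un_le]) (simp add: card_image)
    have close: "dist (p i) (p j) < r" if "linked \<delta> p i j" for i j
      using linked_imp_close[OF finp cardp \<delta>(1) _ that] \<delta>(2) r(2) by simp
    have finI: "finite (cls i)" for i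
      by (rule finite_subset[OF _ finp[of "p i"]]) (use close r in \<open>force simp: cls_def\<close>)
    have card_eq: "card {n. Inl n \<in> cls i} = card {n. Inr n \<in> cls i}" for i
    proof (rule close_tent_convolution_imp_equal_card)
      show finIJ: "finite {n. Inl n \<in> cls i}" "finite {n. Inr n \<in> cls i}"
        using finI[of i] by (auto intro: finite_vimageI[of _ Inl, unfolded vimage_def] finite_vimageI[of _ Inr, unfolded vimage_def])
      have "measure lborel (ball (p i) 2) = V" by (simp add: V_def content_ball)
      then show "\<eta> * measure lborel (ball (p i) 2) < (\<integral>y. tent s y \<partial>(lborel :: 'a measure))"
        using \<eta> by (simp add: c_def)
      show "\<bar>(\<Sum>n | Inl n \<in> cls i. tent s (a n - z)) - (\<Sum>n | Inr n \<in> cls i. tent s (b n - z))\<bar>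
          \<le> \<eta> * indicator (ball (p i) 2) z" for z
      proof (cases "\<exists>k \<in> cls i. dist (p k) z < s")
        case True
        then obtain k where k: "linked \<delta> p i k" "dist (p k) z < s" by (auto simp: cls_def)
        \<comment> \<open>Near a component only its own points contribute, so both sums are full convolutions.\<close>
        have near: "l \<in> cls i" if "dist (p l) z < s" for l
        proof -
          have "dist (p k) (p l) < \<delta>"
            using that k(2) dist_triangle2[of "p k" "p l" z] by (simp add: s_def)
          then show ?thesis using k(1) linked_trans linkedI by (fastforce simp: cls_def)
        qed
        have "?g z = of_real (\<Sum>n | Inl n \<in> cls i. tent s (a n - z))"
          by (rule tent_convolution_eq_sum[OF finIJ(1)]) (use near[of "Inl _"] in simp)
        moreover have "?g (z - \<tau>) = of_real (\<Sum>n | Inr n \<in> cls i. tent s (a n - (z - \<tau>)))"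
          by (rule tent_convolution_eq_sum[OF finIJ(2)])
            (use near[of "Inr _"] in \<open>simp add: b_def dist_norm algebra_simps\<close>)
        ultimately have "\<bar>(\<Sum>n | Inl n \<in> cls i. tent s (a n - z)) - (\<Sum>n | Inr n \<in> cls i. tent s (b n - z))\<bar>
            = norm (?g (z - \<tau>) - ?g z)"
          by (simp add: b_def algebra_simps abs_minus_commute flip: of_real_diff of_real_sum)
        also have "\<dots> \<le> \<eta>" using \<tau>[of z] by simp
        also have "z \<in> ball (p i) 2"
          using close[OF k(1)] k(2) s r dist_triangle[of "p i" z "p k"] by simp
        then have "\<eta> = \<eta> * indicator (ball (p i) 2) z" by simp
        finally show ?thesis .
      next
        case False
        then have "tent s (p k - z) = 0" if "k \<in> cls i" for k
          using that by (auto simp: tent_eq_0_iff dist_norm not_less)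
        from this[of "Inl _"] this[of "Inr _"] show ?thesis using \<eta>(1) by simp
      qed
    qed
    have fibre: "{n. cls (h n) = cls i} = {n. h n \<in> cls i}" for h :: "nat \<Rightarrow> nat + nat" and i
      by (auto simp: cls_def linked_class_eq_iff intro: linked_sym)
    have "finite {n. cls (Inl n) = K} \<and> finite {n. cls (Inr n) = K} \<and>
        card {n. cls (Inl n) = K} = card {n. cls (Inr n) = K}" for K
    proof (cases "\<exists>i. K = cls i")
      case True
      then obtain i where K: "K = cls i" by blast
      show ?thesis
        using card_eq[of i] finite_vimageI[OF finI[of i], of Inl] finite_vimageI[OF finI[of i], of Inr]
        by (simp add: K fibre vimage_def)
    next
      case False
      then have "{n. cls (Inl n) = K} = {}" "{n. cls (Inr n) = K} = {}" by auto
      then show ?thesis by simp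
    qed
    then obtain \<sigma> where \<sigma>: "bij \<sigma>" "\<And>n. cls (Inr (\<sigma> n)) = cls (Inl n)"
      using ex_bij_equal_fibres[of "\<lambda>n. cls (Inl n)" "\<lambda>n. cls (Inr n)"] by blast
    have "dist (a n) (a (\<sigma> n) + \<tau>) \<le> r" for n
    proof -
      have "linked \<delta> p (Inl n) (Inr (\<sigma> n))"
        using \<sigma>(2)[of n] by (simp add: cls_def linked_class_eq_iff linked_sym)
      from close[OF this] show ?thesis by (simp add: b_def)
    qed
    then show ?thesis by (rule almost_periodI[OF \<sigma>(1) _ r(3) \<open>\<epsilon> > 0\<close>])
  qed
  moreover have "relatively_dense {\<tau>. \<forall>x. norm (?g (x - \<tau>) - ?g x) < \<eta>}"
    using almost_periodic_tent_convolution[OF ap] \<eta>(1) by (simp add: almost_periodic_function_def)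
  ultimately show "relatively_dense {\<tau>. almost_period \<epsilon> a \<tau>}"
    by (elim relatively_dense_mono) blast
qed

theorem theorem11:
  fixes a :: "nat \<Rightarrow> real ^ 'k"
  assumes "discrete_multiple_set a"
  shows "almost_periodic_multiple_set a \<longleftrightarrow> almost_periodic_measure (multiple_set_measure a)"
  using assms almost_periodic_measure_if_almost_periodic_multiple_set
    almost_periodic_multiple_set_if_almost_periodic_measure by blast

end
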